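(* Let $0<l<L$, $a>0$, $\sigma>0$ be fixed constants. For initial data $(\varphi,\psi)$ on $[0,L]$ consider the coupled initial-boundary value problem for $u=u(x,t)$, $x\in[0,L]$, $t\ge 0$: $$u_{tt}-a^2u_{xx}=0\quad (0<x<l \text{ or } l<x<L,\ t>0),$$ $$u(0,t)=0,\qquad u(L,t)=0,$$ $$u(l-0,t)=u(l+0,t),\qquad -u_x(l-0,t)+u_x(l+0,t)=\sigma u(l,t),$$ $$u(x,0)=\varphi(x),\qquad u_t(x,0)=\psi(x).$$ The solution is stable with respect to the initial value $(\varphi,\psi)$ in the following sense: for every $\varepsilon>0$ and $T>0$ there exists $\eta>0$, depending only on $\varepsilon$ and $T$ (for the fixed constants $a,\sigma,l,L$), such that if $u_1$ and $u_2$ are classical solutions with initial values $(\varphi_1,\psi_1)$ and $(\varphi_2,\psi_2)$ respectively, and $$\|\psi_1-\psi_2\|_{L^2((0,l))}+\|\psi_1-\psi_2\|_{L^2((l,L))}\le\eta,$$ $$\|\varphi_1-\varphi_2\|_{L^2((0,l))}+\|\varphi_1-\varphi_2\|_{L^2((l,L))}\le\eta,$$ $$\|\varphi_{1x}-\varphi_{2x}\|_{L^2((0,l))}+\|\varphi_{1x}-\varphi_{2x}\|_{L^2((l,L))}\le\eta,$$ then for all $0\le t\le T$, $$\|u_1-u_2\|_{L^2((0,l))}+\|u_1-u_2\|_{L^2((l,L))}\le\varepsilon,$$ $$\|u_{1x}-u_{2x}\|_{L^2((0,l))}+\|u_{1x}-u_{2x}\|_{L^2((l,L))}\le\varepsilon,$$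 $$\|u_{1t}-u_{2t}\|_{L^2((0,l))}+\|u_{1t}-u_{2t}\|_{L^2((l,L))}\le\varepsilon,$$ where the norms are taken in $x$ at time $t$.
   Context: Here $u_x(l\mp 0,t)$ and $u(l\mp 0,t)$ denote the one-sided limits at $x=l$ from the left and from the right. Subscripts $x,t$ denote derivatives. A classical solution is a function $u$ that is continuous on $[0,L]\times[0,\infty)$, whose restrictions to $[0,l]\times[0,\infty)$ and to $[l,L]\times[0,\infty)$ are $C^2$ (one-sided derivatives at the ends), which is $C^1$ in $t$ at $x=l$, and which satisfies all the equations and conditions of the problem pointwise. *)

theory Defs
  imports "HOL-Analysis.Analysis"
begin

text \<open>
  Functions of \<open>(x, t)\<close> are curried total functions \<open>u :: real \<Rightarrow> real \<Rightarrow> real\<close>; only their values for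
  \<open>x \<in> {0..L}\<close> and \<open>t \<ge> 0\<close> matter. The partial derivatives below are taken within
  the set \<open>X\<close> (respectively within \<open>{0..}\<close>), so at the end points they are the one-sided derivatives.
\<close>

definition partial_x :: "real set \<Rightarrow> (real \<Rightarrow> real \<Rightarrow> real) \<Rightarrow> real \<Rightarrow> real \<Rightarrow> real" where
  "partial_x X u x t = vector_derivative (\<lambda>y. u y t) (at x within X)"

definition partial_t :: "(real \<Rightarrow> real \<Rightarrow> real) \<Rightarrow> real \<Rightarrow> real \<Rightarrow> real" where
  "partial_t u x t = vector_derivative (\<lambda>s. u x s) (at t within {0..})"

definition C1_strip :: "real set \<Rightarrow> (real \<Rightarrow> real \<Rightarrow> real) \<Rightarrow> bool" where
  "C1_strip X u \<longleftrightarrow>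
     (\<forall>x\<in>X. \<forall>t\<ge>0. (\<lambda>y. u y t) differentiable (at x within X)) \<and>
     (\<forall>x\<in>X. \<forall>t\<ge>0. (\<lambda>s. u x s) differentiable (at t within {0..})) \<and>
     continuous_on (X \<times> {0..}) (\<lambda>(x, t). u x t) \<and>
     continuous_on (X \<times> {0..}) (\<lambda>(x, t). partial_x X u x t) \<and>
     continuous_on (X \<times> {0..}) (\<lambda>(x, t). partial_t u x t)"

definition C2_strip :: "real set \<Rightarrow> (real \<Rightarrow> real \<Rightarrow> real) \<Rightarrow> bool" where
  "C2_strip X u \<longleftrightarrow>
     C1_strip X u \<and> C1_strip X (partial_x X u) \<and> C1_strip X (partial_t u)"

text \<open>
  In the differential equation and in the one-sided limits at \<open>x = l\<close> all derivatives are taken at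
  interior points, so the ordinary \<open>deriv\<close> is used there. The limits \<open>u(l\<mp>0, t)\<close> and
  \<open>u\<^sub>x(l\<mp>0, t)\<close> are required to exist.
\<close>

definition classical_solution ::
  "real \<Rightarrow> real \<Rightarrow> real \<Rightarrow> real \<Rightarrow> (real \<Rightarrow> real) \<Rightarrow> (real \<Rightarrow> real) \<Rightarrow> (real \<Rightarrow> real \<Rightarrow> real) \<Rightarrow> bool"
where
  "classical_solution a \<sigma> l L \<phi> \<psi> u \<longleftrightarrow>
     continuous_on ({0..L} \<times> {0..}) (\<lambda>(x, t). u x t) \<and>
     C2_strip {0..l} u \<and> C2_strip {l..L} u \<and>
     (\<forall>t\<ge>0. (\<lambda>s. u l s) differentiable (at t within {0..})) \<and>
     continuous_on {0..} (\<lambda>t. partial_t u l t) \<and>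
     (\<forall>x\<in>{0<..<l} \<union> {l<..<L}. \<forall>t>0.
        deriv (deriv (\<lambda>s. u x s)) t - a\<^sup>2 * deriv (deriv (\<lambda>y. u y t)) x = 0) \<and>
     (\<forall>t\<ge>0. u 0 t = 0 \<and> u L t = 0) \<and>
     (\<forall>t\<ge>0. \<exists>c. ((\<lambda>x. u x t) \<longlongrightarrow> c) (at_left l) \<and> ((\<lambda>x. u x t) \<longlongrightarrow> c) (at_right l)) \<and>
     (\<forall>t\<ge>0. \<exists>p q. (deriv (\<lambda>y. u y t) \<longlongrightarrow> p) (at_left l) \<and>
                  (deriv (\<lambda>y. u y t) \<longlongrightarrow> q) (at_right l) \<and>
                  - p + q = \<sigma> * u l t) \<and>
     (\<forall>x\<in>{0..L}. u x 0 = \<phi> x \<and> partial_t u x 0 = \<psi> x)"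

text \<open>
  For classical solutions the functions whose norms are taken are, on each of the two open
  intervals, restrictions of continuous functions on the closed interval; hence their squares are
  integrable and the convention that non-integrable functions have integral \<open>0\<close> plays no role.
\<close>

definition L2_norm_on :: "real set \<Rightarrow> (real \<Rightarrow> real) \<Rightarrow> real" where
  "L2_norm_on A f = sqrt (set_lebesgue_integral lborel A (\<lambda>x. (f x)\<^sup>2))"

definition split_L2_norm :: "real \<Rightarrow> real \<Rightarrow> (real \<Rightarrow> real) \<Rightarrow> real" where
  "split_L2_norm l L f = L2_norm_on {0<..<l} f + L2_norm_on {l<..<L} f"

end

theory Submission
  imports Defs
begin

text \<open>
  The proof is the energy method. The problem is linear and homogeneous, so the difference \<open>v\<close> of two
  classical solutions solves it again, and only \<open>v\<close> has to be controlled by its initial values.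
  Consider
  \<open>E(t) = (\<integral> v\<^sub>t\<^sup>2 + a\<^sup>2 v\<^sub>x\<^sup>2 dx over both intervals) + a\<^sup>2 \<sigma> v(l,t)\<^sup>2\<close>.
  By the wave equation, \<open>\<partial>\<^sub>t (v\<^sub>t\<^sup>2 + a\<^sup>2 v\<^sub>x\<^sup>2) = \<partial>\<^sub>x (2 a\<^sup>2 v\<^sub>t v\<^sub>x)\<close>, so on each interval the integral
  changes only through the energy flux at its two ends. The flux vanishes at the fixed ends \<open>0\<close> and
  \<open>L\<close>, and at \<open>l\<close> the two fluxes add up to \<open>2 a\<^sup>2 v\<^sub>t(l,t) (v\<^sub>x(l-0,t) - v\<^sub>x(l+0,t))
  = - 2 a\<^sup>2 \<sigma> v(l,t) v\<^sub>t(l,t)\<close>, which the point term compensates. Hence \<open>E\<close> is constant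
  (\<open>transmission_energy_conserved\<close>). Since \<open>\<sigma> > 0\<close>, all its terms are nonnegative, and \<open>E(t)\<close>
  bounds the \<open>L\<^sup>2\<close> norms of \<open>v\<^sub>t\<close> and \<open>v\<^sub>x\<close>; because \<open>v\<close> vanishes at an end of each
  interval, the Poincare inequality then bounds the norm of \<open>v\<close> as well. Conversely, at time \<open>0\<close>
  the Cauchy-Schwarz inequality gives \<open>v(l,0)\<^sup>2 \<le> l \<parallel>v\<^sub>x(\<cdot>,0)\<parallel>\<^sup>2\<close>, so \<open>E(0)\<close> is at most
  \<open>(1 + a\<^sup>2 + a\<^sup>2 \<sigma> l) \<eta>\<^sup>2\<close> when the initial norms are at most \<open>\<eta>\<close>
  (\<open>transmission_estimate\<close>).

  Two points of regularity need care. The computation exchanges \<open>\<partial>\<^sub>t \<partial>\<^sub>x v\<close> and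
  \<open>\<partial>\<^sub>x \<partial>\<^sub>t v\<close> (\<open>ux_t\<close>), and it uses the equation and the one-sided slopes up to the boundary of
  the strips, where a classical solution satisfies them by continuity
  (\<open>wave_equation_up_to_boundary\<close>, \<open>classical_solution_jump\<close>).
\<close>

section \<open>Continuity and differentiability on intervals and strips\<close>

lemma continuous_on_curried_compose:
  assumes "continuous_on (X \<times> Y) (\<lambda>(x, t). f x t)"
    and "continuous_on S g" "continuous_on S h"
    and "\<And>z. z \<in> S \<Longrightarrow> g z \<in> X" "\<And>z. z \<in> S \<Longrightarrow> h z \<in> Y"
  shows "continuous_on S (\<lambda>z. f (g z) (h z))"
  using continuous_on_compose2[OF assms(1) continuous_on_Pair[OF assms(2,3)]] assms(4,5)
  by (force simp: split_beta)

lemma derivative_unique_on_interval: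
  fixes f :: "real \<Rightarrow> real"
  assumes "p < q" "x \<in> {p..q}"
    and "(f has_real_derivative D) (at x within {p..q})"
    and "(f has_real_derivative E) (at x within {p..q})"
  shows "D = E"
  using assms vector_derivative_unique_within_closed_interval[of p q x f D E]
  by (simp add: has_real_derivative_iff_has_vector_derivative)

lemma at_within_halfline:
  fixes t T :: real
  assumes "t < T"
  shows "at t within {0..T} = at t within {0..}"
  by (rule at_within_nhd[of _ "{..<T}"]) (use assms in auto)

section \<open>Integral inequalities and norms on an interval\<close>

text \<open>
  With \<open>h = x - c\<close> and \<open>G = \<integral> g\<close>, the inequality is \<open>\<integral> (h g - G)\<^sup>2 \<ge> 0\<close> multiplied out and
  divided by \<open>h\<close>.
\<close>
lemma cauchy_schwarz_interval:
  fixes g :: "real \<Rightarrow> real"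
  assumes g: "continuous_on {c..x} g" and "c \<le> x"
  shows "(integral {c..x} g)\<^sup>2 \<le> (x - c) * integral {c..x} (\<lambda>y. (g y)\<^sup>2)"
proof (cases "c = x")
  case False
  define h where "h = x - c"
  define G where "G = integral {c..x} g"
  have h: "h > 0" using False assms(2) by (simp add: h_def)
  have i: "g integrable_on {c..x}" "(\<lambda>y. (g y)\<^sup>2) integrable_on {c..x}"
    by (intro integrable_continuous_real continuous_intros g)+
  have "((\<lambda>y. h\<^sup>2 * (g y)\<^sup>2 - 2 * h * G * g y + G\<^sup>2) has_integral
      h\<^sup>2 * integral {c..x} (\<lambda>y. (g y)\<^sup>2) - 2 * h * G * G + (x - c) *\<^sub>R G\<^sup>2) {c..x}"
    unfolding G_def using i assms(2) has_integral_const_real[of "(integral {c..x} g)\<^sup>2" c x]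
    by (intro has_integral_add has_integral_diff has_integral_mult_right integrable_integral) auto
  moreover have "h\<^sup>2 * (g y)\<^sup>2 - 2 * h * G * g y + G\<^sup>2 \<ge> 0" for y
  proof -
    have "h\<^sup>2 * (g y)\<^sup>2 - 2 * h * G * g y + G\<^sup>2 = (h * g y - G)\<^sup>2"
      by (simp add: power2_eq_square algebra_simps)
    then show ?thesis by simp
  qed
  ultimately have "h\<^sup>2 * integral {c..x} (\<lambda>y. (g y)\<^sup>2) - 2 * h * G * G + (x - c) *\<^sub>R G\<^sup>2 \<ge> 0"
    by (rule has_integral_nonneg)
  then have "h * (h * integral {c..x} (\<lambda>y. (g y)\<^sup>2) - G\<^sup>2) \<ge> 0"
    by (simp add: h_def[symmetric] power2_eq_square algebra_simps)
  then show ?thesis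
    using h by (simp add: zero_le_mult_iff G_def h_def)
qed simp

text \<open>
  The increment of \<open>w\<close> is the integral of its derivative, to which the Cauchy-Schwarz inequality
  applies; the squared increment is symmetric in the two points, so they may be taken in order.
\<close>
lemma oscillation_bound:
  fixes w g :: "real \<Rightarrow> real"
  assumes w: "\<And>y. y \<in> {p..q} \<Longrightarrow> (w has_real_derivative g y) (at y within {p..q})"
    and g: "continuous_on {p..q} g"
    and "c \<in> {p..q}" "x \<in> {p..q}"
  shows "(w x - w c)\<^sup>2 \<le> (q - p) * integral {p..q} (\<lambda>y. (g y)\<^sup>2)"
  using assms(3,4)
proof (induction c x rule: linorder_wlog)
  case (le c x)
  have sub: "{c..x} \<subseteq> {p..q}" using le by auto
  have "(g has_integral w x - w c) {c..x}"
    using le sub w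
    by (intro fundamental_theorem_of_calculus)
       (auto simp flip: has_real_derivative_iff_has_vector_derivative
             intro!: DERIV_subset[OF w])
  then have "(w x - w c)\<^sup>2 \<le> (x - c) * integral {c..x} (\<lambda>y. (g y)\<^sup>2)"
    using cauchy_schwarz_interval[OF continuous_on_subset[OF g sub]] le
    by (simp add: integral_unique)
  also have "\<dots> \<le> (q - p) * integral {p..q} (\<lambda>y. (g y)\<^sup>2)"
    using le sub continuous_on_subset[OF g sub] g
    by (intro mult_mono integral_subset_le integral_nonneg integrable_continuous_real
        continuous_intros) auto
  finally show ?case .
next
  case (sym c x)
  then show ?case by (simp add: power2_commute)
qed

lemma poincare_inequality:
  fixes w g :: "real \<Rightarrow> real"
  assumes w: "\<And>y. y \<in> {p..q} \<Longrightarrow> (w has_real_derivative g y) (at y within {p..q})"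
    and g: "continuous_on {p..q} g"
    and c: "c \<in> {p..q}" "w c = 0"
  shows "integral {p..q} (\<lambda>y. (w y)\<^sup>2) \<le> (q - p)\<^sup>2 * integral {p..q} (\<lambda>y. (g y)\<^sup>2)"
proof -
  have "continuous_on {p..q} w"
    using w by (rule DERIV_continuous_on)
  then have "integral {p..q} (\<lambda>y. (w y)\<^sup>2)
      \<le> integral {p..q} (\<lambda>_. (q - p) * integral {p..q} (\<lambda>y. (g y)\<^sup>2))"
    using oscillation_bound[OF w g c(1)] c(2)
    by (intro integral_le integrable_continuous_real continuous_intros) auto
  then show ?thesis
    using c by (simp add: power2_eq_square mult.assoc)
qed

text \<open>
  A two-sided derivative \<open>deriv\<close> agrees with the continuous one-sided slope only inside the interval;
  the end points do not affect the integral. Passing to the continuous function on the closed interval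
  makes the gauge integral and its calculus available.
\<close>
lemma L2_norm_on_eq_integral:
  assumes g: "continuous_on {p..q} g" and fg: "\<And>x. x \<in> {p<..<q} \<Longrightarrow> f x = g x"
  shows "L2_norm_on {p<..<q} f = sqrt (integral {p..q} (\<lambda>x. (g x)\<^sup>2))"
proof -
  have "set_integrable lborel {p..q} (\<lambda>x. (g x)\<^sup>2)"
    by (intro borel_integrable_atLeastAtMost' continuous_intros g)
  then have int: "set_integrable lborel {p<..<q} (\<lambda>x. (g x)\<^sup>2)"
    by (rule set_integrable_subset) auto
  have "set_lebesgue_integral lborel {p<..<q} (\<lambda>x. (f x)\<^sup>2)
      = set_lebesgue_integral lborel {p<..<q} (\<lambda>x. (g x)\<^sup>2)"
    using fg by (intro set_lebesgue_integral_cong) auto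
  also have "\<dots> = integral {p..q} (\<lambda>x. (g x)\<^sup>2)"
    using set_borel_integral_eq_integral(2)[OF int] integral_open_interval_real by metis
  finally show ?thesis by (simp add: L2_norm_on_def)
qed

section \<open>Energy balance for the wave equation on one strip\<close>

text \<open>
  A solution of the wave equation on a closed strip, presented by its derivatives as explicit
  functions. This form is stable under differences, whereas derivatives given by a choice operator
  would have to be compared anew for each combination of solutions. The equation itself is built into
  \<open>ut_t\<close>: the value given for \<open>u\<^sub>t\<^sub>t\<close> is \<open>a\<^sup>2 u\<^sub>x\<^sub>x\<close>.
\<close>
locale wave_strip =
  fixes a p q :: real and u ux ut utx uxx :: "real \<Rightarrow> real \<Rightarrow> real"
  assumes p_less_q: "p < q"
    and u_x: "\<lbrakk>x \<in> {p..q}; 0 \<le> t\<rbrakk> \<Longrightarrow>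
      ((\<lambda>y. u y t) has_real_derivative ux x t) (at x within {p..q})"
    and u_t: "\<lbrakk>x \<in> {p..q}; 0 \<le> t\<rbrakk> \<Longrightarrow>
      ((\<lambda>s. u x s) has_real_derivative ut x t) (at t within {0..})"
    and ux_x: "\<lbrakk>x \<in> {p..q}; 0 \<le> t\<rbrakk> \<Longrightarrow>
      ((\<lambda>y. ux y t) has_real_derivative uxx x t) (at x within {p..q})"
    and ut_x: "\<lbrakk>x \<in> {p..q}; 0 \<le> t\<rbrakk> \<Longrightarrow>
      ((\<lambda>y. ut y t) has_real_derivative utx x t) (at x within {p..q})"
    and ut_t: "\<lbrakk>x \<in> {p..q}; 0 \<le> t\<rbrakk> \<Longrightarrow>
      ((\<lambda>s. ut x s) has_real_derivative a\<^sup>2 * uxx x t) (at t within {0..})"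
    and cont_ux: "continuous_on ({p..q} \<times> {0..}) (\<lambda>(x, t). ux x t)"
    and cont_ut: "continuous_on ({p..q} \<times> {0..}) (\<lambda>(x, t). ut x t)"
    and cont_utx: "continuous_on ({p..q} \<times> {0..}) (\<lambda>(x, t). utx x t)"
    and cont_uxx: "continuous_on ({p..q} \<times> {0..}) (\<lambda>(x, t). uxx x t)"
begin

text \<open>
  This is the symmetry of the mixed derivatives in integrated form. Differentiate
  \<open>u(x,s) - u(x,0) = \<integral> u\<^sub>t(x,\<tau>) d\<tau>\<close> with respect to \<open>x\<close>: the left-hand side gives the increment
  of \<open>u\<^sub>x\<close>, and the Leibniz rule gives the integral of \<open>u\<^sub>t\<^sub>x\<close>.
\<close>
lemma ux_increment:
  assumes x: "x \<in> {p..q}" and s: "0 \<le> s"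
  shows "ux x s - ux x 0 = integral {0..s} (\<lambda>\<tau>. utx x \<tau>)"
proof -
  have u_increment: "((\<lambda>\<tau>. ut y \<tau>) has_integral u y s - u y 0) {0..s}" if "y \<in> {p..q}" for y
    using that s u_t
    by (intro fundamental_theorem_of_calculus)
       (auto simp flip: has_real_derivative_iff_has_vector_derivative
             intro!: DERIV_subset[OF u_t])
  have "((\<lambda>y. integral (cbox 0 s) (ut y)) has_real_derivative integral (cbox 0 s) (utx x))
      (at x within {p..q})"
    using x ut_x u_increment
    by (intro leibniz_rule_field_derivative continuous_on_subset[OF cont_utx])
       (auto intro: has_integral_integrable)
  then have "((\<lambda>y. u y s - u y 0) has_real_derivative integral {0..s} (utx x)) (at x within {p..q})"
    using x u_increment
    by (simp add: has_field_derivative_def)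
       (erule has_derivative_transform[rotated 2], auto simp: integral_unique[OF u_increment])
  moreover have "((\<lambda>y. u y s - u y 0) has_real_derivative ux x s - ux x 0) (at x within {p..q})"
    using x s by (intro DERIV_diff u_x) auto
  ultimately show ?thesis
    using derivative_unique_on_interval[OF p_less_q x] by blast
qed

lemma ux_t:
  assumes x: "x \<in> {p..q}" and t: "0 \<le> t"
  shows "((\<lambda>s. ux x s) has_real_derivative utx x t) (at t within {0..})"
proof -
  have "continuous_on {0..t+1} (\<lambda>s. utx x s)"
    by (rule continuous_on_curried_compose[OF cont_utx]) (use x in \<open>auto intro: continuous_intros\<close>)
  then have "((\<lambda>s. integral {0..s} (\<lambda>\<tau>. utx x \<tau>)) has_real_derivative utx x t)
      (at t within {0..t+1})"
    using t by (intro integral_has_real_derivative) auto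
  then have "((\<lambda>s. ux x s - ux x 0) has_real_derivative utx x t) (at t within {0..t+1})"
    unfolding has_field_derivative_def
    by (rule has_derivative_transform[rotated 2]) (use t ux_increment[OF x] in auto)
  then have "((\<lambda>s. (ux x s - ux x 0) + ux x 0) has_real_derivative utx x t + 0)
      (at t within {0..t+1})"
    by (rule DERIV_add) (rule DERIV_const)
  then have "((\<lambda>s. ux x s) has_real_derivative utx x t) (at t within {0..t+1})"
    by simp
  then show ?thesis
    using at_within_halfline[of t "t+1"] by simp
qed

lemma continuous_slices:
  assumes "0 \<le> t"
  shows "continuous_on {p..q} (\<lambda>x. ux x t)" "continuous_on {p..q} (\<lambda>x. ut x t)"
  using assms continuous_on_curried_compose[OF cont_ux, of "{p..q}" "\<lambda>x. x" "\<lambda>_. t"]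
    continuous_on_curried_compose[OF cont_ut, of "{p..q}" "\<lambda>x. x" "\<lambda>_. t"]
  by auto

definition strip_energy :: "real \<Rightarrow> real" where
  "strip_energy t = integral {p..q} (\<lambda>x. (ut x t)\<^sup>2 + a\<^sup>2 * (ux x t)\<^sup>2)"

lemma strip_energy_split:
  assumes "0 \<le> t"
  shows "strip_energy t = integral {p..q} (\<lambda>x. (ut x t)\<^sup>2) + a\<^sup>2 * integral {p..q} (\<lambda>x. (ux x t)\<^sup>2)"
  unfolding strip_energy_def using continuous_slices[OF assms]
  by (subst integral_add) (auto intro!: integrable_continuous_real continuous_intros)

text \<open>
  The time derivative of the energy density is \<open>2 a\<^sup>2 (u\<^sub>t\<^sub>x u\<^sub>x + u\<^sub>t u\<^sub>x\<^sub>x)\<close>, by the wave equation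
  and the symmetry of mixed derivatives. This is the \<open>x\<close>-derivative of \<open>2 a\<^sup>2 u\<^sub>t u\<^sub>x\<close>, so only
  the flux through the two ends remains.
\<close>
lemma strip_energy_derivative:
  assumes t: "0 \<le> t"
  shows "(strip_energy has_real_derivative 2 * a\<^sup>2 * (ut q t * ux q t - ut p t * ux p t))
    (at t within {0..})"
proof -
  define F where "F s x = 2 * a\<^sup>2 * (utx x s * ux x s + ut x s * uxx x s)" for s x
  have swap: "continuous_on ({0..} \<times> {p..q}) (\<lambda>z. f (snd z) (fst z))"
    if "continuous_on ({p..q} \<times> {0..}) (\<lambda>(x, t). f x t)" for f :: "real \<Rightarrow> real \<Rightarrow> real"
    by (rule continuous_on_curried_compose[OF that]) (auto intro: continuous_intros)
  have "continuous_on ({0..} \<times> {p..q}) (\<lambda>(s, x). F s x)"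
    unfolding F_def split_beta
    by (intro continuous_intros swap cont_ux cont_ut cont_utx cont_uxx)
  moreover have "((\<lambda>s. (ut x s)\<^sup>2 + a\<^sup>2 * (ux x s)\<^sup>2) has_real_derivative F s x) (at s within {0..})"
    if "s \<in> {0..}" "x \<in> cbox p q" for s x
  proof -
    have "x \<in> {p..q}" "0 \<le> s" using that by auto
    note ut_t[OF this, derivative_intros] ux_t[OF this, derivative_intros]
    show ?thesis
      unfolding F_def
      by (rule derivative_eq_intros refl | simp add: algebra_simps)+
  qed
  moreover have "(\<lambda>x. (ut x s)\<^sup>2 + a\<^sup>2 * (ux x s)\<^sup>2) integrable_on cbox p q" if "s \<in> {0..}" for s
    using that continuous_slices[of s]
    by (auto intro!: integrable_continuous_real continuous_intros)
  ultimately have "((\<lambda>s. integral (cbox p q) (\<lambda>x. (ut x s)\<^sup>2 + a\<^sup>2 * (ux x s)\<^sup>2))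
      has_real_derivative integral (cbox p q) (F t)) (at t within {0..})"
    using t by (intro leibniz_rule_field_derivative) auto
  moreover have "(F t has_integral 2 * a\<^sup>2 * (ut q t * ux q t) - 2 * a\<^sup>2 * (ut p t * ux p t)) {p..q}"
  proof (intro fundamental_theorem_of_calculus)
    fix x assume "x \<in> {p..q}"
    note ut_x[OF this t, derivative_intros] ux_x[OF this t, derivative_intros]
    show "((\<lambda>x. 2 * a\<^sup>2 * (ut x t * ux x t)) has_vector_derivative F t x) (at x within {p..q})"
      unfolding F_def has_real_derivative_iff_has_vector_derivative[symmetric]
      by (rule derivative_eq_intros refl | simp add: algebra_simps)+
  qed (use p_less_q in simp)
  ultimately show ?thesis
    unfolding strip_energy_def[abs_def]
    by (simp add: integral_unique right_diff_distrib)
qed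

end

lemma wave_strip_diff:
  assumes "wave_strip a p q u ux ut utx uxx" "wave_strip a p q v vx vt vtx vxx"
  shows "wave_strip a p q (\<lambda>x t. u x t - v x t) (\<lambda>x t. ux x t - vx x t) (\<lambda>x t. ut x t - vt x t)
    (\<lambda>x t. utx x t - vtx x t) (\<lambda>x t. uxx x t - vxx x t)"
proof -
  interpret u: wave_strip a p q u ux ut utx uxx by fact
  interpret v: wave_strip a p q v vx vt vtx vxx by fact
  show ?thesis
  proof
    fix x t :: real assume *: "x \<in> {p..q}" "0 \<le> t"
    show "((\<lambda>s. ut x s - vt x s) has_real_derivative a\<^sup>2 * (uxx x t - vxx x t)) (at t within {0..})"
      using DERIV_diff[OF u.ut_t[OF *] v.ut_t[OF *]] by (simp add: right_diff_distrib)
  qed (use u.p_less_q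
      continuous_on_diff[OF u.cont_ux v.cont_ux] continuous_on_diff[OF u.cont_ut v.cont_ut]
      continuous_on_diff[OF u.cont_utx v.cont_utx] continuous_on_diff[OF u.cont_uxx v.cont_uxx]
      in \<open>auto simp: split_beta
          intro!: DERIV_diff u.u_x v.u_x u.u_t v.u_t u.ux_x v.ux_x u.ut_x v.ut_x\<close>)
qed

section \<open>Two strips coupled by the jump condition\<close>

text \<open>
  Here \<open>d\<close> and \<open>d'\<close> are the slopes \<open>v\<^sub>x\<close> on the left and on the right strip, which differ at
  \<open>l\<close>, and \<open>e\<close> is the velocity \<open>v\<^sub>t\<close>, common to both strips. The weight \<open>a\<^sup>2 \<sigma>\<close> of the point
  term is the one for which its derivative \<open>2 a\<^sup>2 \<sigma> v(l,t) v\<^sub>t(l,t)\<close> cancels the net flux at \<open>l\<close>.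
\<close>
lemma transmission_energy_conserved:
  assumes left: "wave_strip a 0 l v d e m r" and right: "wave_strip a l L v d' e m' r'"
    and boundary: "\<And>t. 0 \<le> t \<Longrightarrow> v 0 t = 0" "\<And>t. 0 \<le> t \<Longrightarrow> v L t = 0"
    and jump: "\<And>t. 0 \<le> t \<Longrightarrow> - d l t + d' l t = \<sigma> * v l t"
    and t: "0 \<le> t"
  shows "wave_strip.strip_energy a 0 l d e t + wave_strip.strip_energy a l L d' e t
      + a\<^sup>2 * \<sigma> * (v l t)\<^sup>2
    = wave_strip.strip_energy a 0 l d e 0 + wave_strip.strip_energy a l L d' e 0
      + a\<^sup>2 * \<sigma> * (v l 0)\<^sup>2"
proof -
  interpret left: wave_strip a 0 l v d e m r by fact
  interpret right: wave_strip a l L v d' e m' r' by fact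
  define E where "E s = left.strip_energy s + right.strip_energy s + a\<^sup>2 * \<sigma> * (v l s)\<^sup>2" for s
  have e_zero: "e x s = 0"
    if "\<And>s. 0 \<le> s \<Longrightarrow> v x s = 0" "x \<in> {0, L}" "0 \<le> s" for x s
  proof -
    have "((\<lambda>s. v x s) has_real_derivative e x s) (at s within {0..})"
      using that left.u_t[of 0 s] right.u_t[of L s] left.p_less_q right.p_less_q by auto
    then have "((\<lambda>s. v x s) has_real_derivative e x s) (at s within {0..s+1})"
      using at_within_halfline[of s "s+1"] by simp
    moreover have "((\<lambda>s. v x s) has_real_derivative 0) (at s within {0..s+1})"
      unfolding has_field_derivative_def
      by (rule has_derivative_transform[where f="\<lambda>_. 0"])
         (use that in \<open>auto intro!: derivative_eq_intros\<close>)
    ultimately show ?thesis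
      using that(3) by (intro derivative_unique_on_interval[of 0 "s+1" s]) auto
  qed
  have "(E has_real_derivative 0) (at s within {0..})" if "s \<in> {0..}" for s
  proof -
    from that have s: "0 \<le> s" and l: "l \<in> {0..l}" using left.p_less_q by auto
    have e0: "e 0 s = 0" and eL: "e L s = 0"
      using s by (auto intro: e_zero boundary)
    \<comment> \<open>The exponents in the last summand are left as the power rule produces them.\<close>
    have "(E has_real_derivative
          2 * a\<^sup>2 * (e l s * d l s - e 0 s * d 0 s) + 2 * a\<^sup>2 * (e L s * d' L s - e l s * d' l s)
          + a\<^sup>2 * \<sigma> * (of_nat 2 * (e l s * v l s ^ (2 - Suc 0)))) (at s within {0..})"
      unfolding E_def[abs_def]
      by (intro DERIV_add DERIV_cmult DERIV_power left.strip_energy_derivative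
          right.strip_energy_derivative left.u_t l s)
    then have "(E has_real_derivative 2 * a\<^sup>2 * (e l s * (d l s - d' l s + \<sigma> * v l s)))
        (at s within {0..})"
      by (rule DERIV_cong) (simp add: e0 eL algebra_simps)
    moreover have "d l s - d' l s + \<sigma> * v l s = 0"
      using jump[OF s] by simp
    ultimately show ?thesis by simp
  qed
  then obtain c where "\<forall>s\<in>{0..}. E s = c"
    using has_field_derivative_zero_constant[OF convex_real_interval(1)] by blast
  then show ?thesis
    using t by (simp add: E_def)
qed

text \<open>
  The energy is bounded by \<open>B\<^sup>2\<close> at time \<open>0\<close>, hence at time \<open>t\<close>. It dominates each of its
  nonnegative terms, so each half of the velocity norm is at most \<open>B\<close> and each half of the slope norm
  at most \<open>B / a\<close>; the Poincare inequality costs a factor \<open>L\<close> for \<open>v\<close> itself.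
\<close>
lemma transmission_estimate:
  assumes "0 < a" "0 < \<sigma>"
    and left: "wave_strip a 0 l v d e m r" and right: "wave_strip a l L v d' e m' r'"
    and boundary: "\<And>t. 0 \<le> t \<Longrightarrow> v 0 t = 0" "\<And>t. 0 \<le> t \<Longrightarrow> v L t = 0"
    and jump: "\<And>t. 0 \<le> t \<Longrightarrow> - d l t + d' l t = \<sigma> * v l t"
    and t: "0 \<le> t"
    and velocity: "sqrt (integral {0..l} (\<lambda>x. (e x 0)\<^sup>2))
      + sqrt (integral {l..L} (\<lambda>x. (e x 0)\<^sup>2)) \<le> \<eta>"
    and slope: "sqrt (integral {0..l} (\<lambda>x. (d x 0)\<^sup>2))
      + sqrt (integral {l..L} (\<lambda>x. (d' x 0)\<^sup>2)) \<le> \<eta>"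
  defines "B \<equiv> \<eta> * sqrt (1 + a\<^sup>2 + a\<^sup>2 * \<sigma> * l)"
  shows "sqrt (integral {0..l} (\<lambda>x. (e x t)\<^sup>2)) + sqrt (integral {l..L} (\<lambda>x. (e x t)\<^sup>2)) \<le> 2 * B"
    and "sqrt (integral {0..l} (\<lambda>x. (d x t)\<^sup>2)) + sqrt (integral {l..L} (\<lambda>x. (d' x t)\<^sup>2))
      \<le> 2 * (B / a)"
    and "sqrt (integral {0..l} (\<lambda>x. (v x t)\<^sup>2)) + sqrt (integral {l..L} (\<lambda>x. (v x t)\<^sup>2))
      \<le> 2 * (B * L / a)"
proof -
  interpret left: wave_strip a 0 l v d e m r by fact
  interpret right: wave_strip a l L v d' e m' r' by fact
  note less = left.p_less_q right.p_less_q
  define K where "K = 1 + a\<^sup>2 + a\<^sup>2 * \<sigma> * l"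
  have nonneg: "0 \<le> integral {0..l} (\<lambda>x. (e x s)\<^sup>2)" "0 \<le> integral {l..L} (\<lambda>x. (e x s)\<^sup>2)"
    "0 \<le> integral {0..l} (\<lambda>x. (d x s)\<^sup>2)" "0 \<le> integral {l..L} (\<lambda>x. (d' x s)\<^sup>2)"
    if "0 \<le> s" for s
    using left.continuous_slices[OF that] right.continuous_slices[OF that]
    by (auto intro!: integral_nonneg integrable_continuous_real continuous_intros)
  have "0 \<le> sqrt (integral {0..l} (\<lambda>x. (e x 0)\<^sup>2)) + sqrt (integral {l..L} (\<lambda>x. (e x 0)\<^sup>2))"
    using nonneg[of 0] by simp
  then have \<eta>: "0 \<le> \<eta>"
    using velocity by linarith
  have K: "0 \<le> K" using assms(1,2) less by (simp add: K_def)
  have B: "0 \<le> B" "B\<^sup>2 = \<eta>\<^sup>2 * K"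
    using \<eta> K by (auto simp: B_def K_def power_mult_distrib)
  (* The hypotheses bound sums of norms, whereas the energy contains sums of squared norms. *)
  have sum_squares: "i + j \<le> \<eta>\<^sup>2" if "0 \<le> i" "0 \<le> j" "sqrt i + sqrt j \<le> \<eta>" for i j
  proof -
    have "i + j \<le> (sqrt i + sqrt j)\<^sup>2"
      using that by (simp add: power2_sum)
    also have "\<dots> \<le> \<eta>\<^sup>2"
      using that by (intro power_mono) auto
    finally show ?thesis .
  qed
  have e0: "integral {0..l} (\<lambda>x. (e x 0)\<^sup>2) + integral {l..L} (\<lambda>x. (e x 0)\<^sup>2) \<le> \<eta>\<^sup>2"
    using sum_squares[OF _ _ velocity] nonneg[of 0] by simp
  have d0: "integral {0..l} (\<lambda>x. (d x 0)\<^sup>2) + integral {l..L} (\<lambda>x. (d' x 0)\<^sup>2) \<le> \<eta>\<^sup>2"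
    using sum_squares[OF _ _ slope] nonneg[of 0] by simp
  have "(v l 0 - v 0 0)\<^sup>2 \<le> (l - 0) * integral {0..l} (\<lambda>x. (d x 0)\<^sup>2)"
    using less by (intro oscillation_bound left.u_x left.continuous_slices) auto
  also have "\<dots> \<le> l * \<eta>\<^sup>2"
    using d0 nonneg[of 0] less by (simp add: mult_left_mono)
  finally have v0: "(v l 0)\<^sup>2 \<le> l * \<eta>\<^sup>2"
    using boundary(1)[of 0] by simp
  have "left.strip_energy t + right.strip_energy t + a\<^sup>2 * \<sigma> * (v l t)\<^sup>2
      = left.strip_energy 0 + right.strip_energy 0 + a\<^sup>2 * \<sigma> * (v l 0)\<^sup>2"
    by (rule transmission_energy_conserved[OF left right boundary jump t])
  also have "\<dots> = (integral {0..l} (\<lambda>x. (e x 0)\<^sup>2) + integral {l..L} (\<lambda>x. (e x 0)\<^sup>2))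
      + a\<^sup>2 * (integral {0..l} (\<lambda>x. (d x 0)\<^sup>2) + integral {l..L} (\<lambda>x. (d' x 0)\<^sup>2))
      + a\<^sup>2 * \<sigma> * (v l 0)\<^sup>2"
    by (simp add: left.strip_energy_split right.strip_energy_split algebra_simps)
  also have "\<dots> \<le> \<eta>\<^sup>2 + a\<^sup>2 * \<eta>\<^sup>2 + a\<^sup>2 * \<sigma> * (l * \<eta>\<^sup>2)"
    using assms(1,2) by (intro add_mono e0 mult_left_mono d0 v0) auto
  also have "\<dots> = B\<^sup>2"
    by (simp add: B(2) K_def algebra_simps)
  finally have energy: "left.strip_energy t + right.strip_energy t + a\<^sup>2 * \<sigma> * (v l t)\<^sup>2 \<le> B\<^sup>2" .
  have "0 \<le> a\<^sup>2 * \<sigma> * (v l t)\<^sup>2"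
    using assms(2) by simp
  moreover have "0 \<le> a\<^sup>2 * integral {0..l} (\<lambda>x. (d x t)\<^sup>2)"
    "0 \<le> a\<^sup>2 * integral {l..L} (\<lambda>x. (d' x t)\<^sup>2)"
    using nonneg[OF t] by simp_all
  ultimately have e: "integral {0..l} (\<lambda>x. (e x t)\<^sup>2) \<le> B\<^sup>2" "integral {l..L} (\<lambda>x. (e x t)\<^sup>2) \<le> B\<^sup>2"
    and "a\<^sup>2 * integral {0..l} (\<lambda>x. (d x t)\<^sup>2) \<le> B\<^sup>2" "a\<^sup>2 * integral {l..L} (\<lambda>x. (d' x t)\<^sup>2) \<le> B\<^sup>2"
    using energy nonneg[OF t] left.strip_energy_split[OF t] right.strip_energy_split[OF t]
    by linarith+
  then have d: "integral {0..l} (\<lambda>x. (d x t)\<^sup>2) \<le> (B / a)\<^sup>2"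
      "integral {l..L} (\<lambda>x. (d' x t)\<^sup>2) \<le> (B / a)\<^sup>2"
    using assms(1) by (simp_all add: power_divide field_simps)
  have "integral {0..l} (\<lambda>x. (v x t)\<^sup>2) \<le> (l - 0)\<^sup>2 * integral {0..l} (\<lambda>x. (d x t)\<^sup>2)"
    using less t boundary(1) left.continuous_slices
    by (intro poincare_inequality[where c=0] left.u_x) auto
  also have "\<dots> \<le> L\<^sup>2 * (B / a)\<^sup>2"
    using less d nonneg[OF t] by (intro mult_mono power_mono) auto
  also have "\<dots> = (B * L / a)\<^sup>2"
    by (simp add: power_mult_distrib power_divide)
  finally have v1: "integral {0..l} (\<lambda>x. (v x t)\<^sup>2) \<le> (B * L / a)\<^sup>2" .
  have "integral {l..L} (\<lambda>x. (v x t)\<^sup>2) \<le> (L - l)\<^sup>2 * integral {l..L} (\<lambda>x. (d' x t)\<^sup>2)"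
    using less t boundary(2) right.continuous_slices
    by (intro poincare_inequality[where c=L] right.u_x) auto
  also have "\<dots> \<le> L\<^sup>2 * (B / a)\<^sup>2"
    using less d nonneg[OF t] by (intro mult_mono power_mono) auto
  also have "\<dots> = (B * L / a)\<^sup>2"
    by (simp add: power_mult_distrib power_divide)
  finally have v2: "integral {l..L} (\<lambda>x. (v x t)\<^sup>2) \<le> (B * L / a)\<^sup>2" .
  have "0 \<le> B / a" "0 \<le> B * L / a"
    using B assms(1) less by auto
  then have "sqrt (integral {0..l} (\<lambda>x. (e x t)\<^sup>2)) \<le> B" "sqrt (integral {l..L} (\<lambda>x. (e x t)\<^sup>2)) \<le> B"
    "sqrt (integral {0..l} (\<lambda>x. (d x t)\<^sup>2)) \<le> B / a" "sqrt (integral {l..L} (\<lambda>x. (d' x t)\<^sup>2)) \<le> B / a"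
    "sqrt (integral {0..l} (\<lambda>x. (v x t)\<^sup>2)) \<le> B * L / a"
    "sqrt (integral {l..L} (\<lambda>x. (v x t)\<^sup>2)) \<le> B * L / a"
    using e d v1 v2 B(1) by (auto intro: real_le_lsqrt)
  then show "sqrt (integral {0..l} (\<lambda>x. (e x t)\<^sup>2)) + sqrt (integral {l..L} (\<lambda>x. (e x t)\<^sup>2)) \<le> 2 * B"
    "sqrt (integral {0..l} (\<lambda>x. (d x t)\<^sup>2)) + sqrt (integral {l..L} (\<lambda>x. (d' x t)\<^sup>2))
      \<le> 2 * (B / a)"
    "sqrt (integral {0..l} (\<lambda>x. (v x t)\<^sup>2)) + sqrt (integral {l..L} (\<lambda>x. (v x t)\<^sup>2))
      \<le> 2 * (B * L / a)"
    by linarith+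
qed

section \<open>Classical solutions as solutions on two closed strips\<close>
lemma partial_x_eq_deriv:
  assumes "x \<in> {p<..<q}"
    and "(\<lambda>y. u y t) differentiable (at x within {p..q})"
  shows "((\<lambda>y. u y t) has_real_derivative partial_x {p..q} u x t) (at x)"
    "deriv (\<lambda>y. u y t) x = partial_x {p..q} u x t"
proof -
  have "at x within {p..q} = at x"
    using assms(1) by (intro at_within_interior) simp
  then show "((\<lambda>y. u y t) has_real_derivative partial_x {p..q} u x t) (at x)"
    using assms(2) unfolding partial_x_def
    by (simp add: vector_derivative_works has_real_derivative_iff_has_vector_derivative)
  then show "deriv (\<lambda>y. u y t) x = partial_x {p..q} u x t"
    by (rule DERIV_imp_deriv)
qed

lemma partial_t_eq_deriv:
  assumes "0 < t" and "(\<lambda>s. u x s) differentiable (at t within {0..})"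
  shows "deriv (\<lambda>s. u x s) t = partial_t u x t"
proof -
  have "at t within {0..} = at t"
    using assms(1) by (intro at_within_interior) simp
  then have "((\<lambda>s. u x s) has_real_derivative partial_t u x t) (at t)"
    using assms(2) unfolding partial_t_def
    by (simp add: vector_derivative_works has_real_derivative_iff_has_vector_derivative)
  then show ?thesis
    by (rule DERIV_imp_deriv)
qed

lemma C1_strip_derivatives:
  assumes "C1_strip {p..q} u" "x \<in> {p..q}" "0 \<le> t"
  shows "((\<lambda>y. u y t) has_real_derivative partial_x {p..q} u x t) (at x within {p..q})"
    and "((\<lambda>s. u x s) has_real_derivative partial_t u x t) (at t within {0..})"
  using assms unfolding C1_strip_def partial_x_def partial_t_def
  by (auto simp: has_real_derivative_iff_has_vector_derivative vector_derivative_works)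

text \<open>
  All second derivatives are continuous on the closed strip, and the open strip, where the equation is
  given, is dense in it.
\<close>
lemma wave_equation_up_to_boundary:
  assumes pq: "p < q" and C2: "C2_strip {p..q} u"
    and pde: "\<And>x t. \<lbrakk>x \<in> {p<..<q}; 0 < t\<rbrakk> \<Longrightarrow>
      deriv (deriv (\<lambda>s. u x s)) t - a\<^sup>2 * deriv (deriv (\<lambda>y. u y t)) x = 0"
    and x: "x \<in> {p..q}" and t: "0 \<le> t"
  shows "partial_t (partial_t u) x t = a\<^sup>2 * partial_x {p..q} (partial_x {p..q} u) x t"
proof -
  note C1 = C2[unfolded C2_strip_def]
  define R where "R = (\<lambda>(x, t). partial_t (partial_t u) x t
    - a\<^sup>2 * partial_x {p..q} (partial_x {p..q} u) x t)"
  have "R z = 0" if z: "z \<in> {p<..<q} \<times> {0<..}" for z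
  proof -
    obtain x t where [simp]: "z = (x, t)" and x: "x \<in> {p<..<q}" and t: "0 < t"
      using z by auto
    have "deriv (deriv (\<lambda>y. u y t)) x = deriv (\<lambda>y. partial_x {p..q} u y t) x"
    proof (rule deriv_cong_ev)
      show "\<forall>\<^sub>F y in nhds x. deriv (\<lambda>y. u y t) y = partial_x {p..q} u y t"
        using eventually_nhds_in_open[of "{p<..<q}" x] x
        by (auto elim!: eventually_mono intro!: partial_x_eq_deriv(2)
            simp: C1[unfolded C1_strip_def] less_imp_le[OF t])
    qed simp
    also have "\<dots> = partial_x {p..q} (partial_x {p..q} u) x t"
      using x t C1 by (intro partial_x_eq_deriv(2)) (auto simp: C1_strip_def)
    finally have xx: "deriv (deriv (\<lambda>y. u y t)) x = partial_x {p..q} (partial_x {p..q} u) x t" .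
    have "deriv (deriv (\<lambda>s. u x s)) t = deriv (\<lambda>s. partial_t u x s) t"
    proof (rule deriv_cong_ev)
      show "\<forall>\<^sub>F s in nhds t. deriv (\<lambda>s. u x s) s = partial_t u x s"
        using eventually_nhds_in_open[of "{0<..}" t] t x C1
        by (auto elim!: eventually_mono intro!: partial_t_eq_deriv simp: C1_strip_def)
    qed simp
    also have "\<dots> = partial_t (partial_t u) x t"
      using x t C1 by (intro partial_t_eq_deriv) (auto simp: C1_strip_def)
    finally have tt: "deriv (deriv (\<lambda>s. u x s)) t = partial_t (partial_t u) x t" .
    show ?thesis
      using pde[OF x t] by (simp add: R_def xx tt)
  qed
  moreover have cl: "closure ({p<..<q} \<times> {0<..}) = {p..q} \<times> {0::real..}"
    using pq by (simp add: closure_Times)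
  moreover have "continuous_on ({p..q} \<times> {0..}) R"
    using C1 unfolding R_def split_beta C1_strip_def
    by (intro continuous_intros) auto
  ultimately have "R (x, t) = 0"
    using continuous_constant_on_closure[of "{p<..<q} \<times> {0<..}" R 0 "(x, t)"] x t by auto
  then show ?thesis by (simp add: R_def)
qed

lemma wave_strip_of_C2:
  assumes "p < q" and "C2_strip {p..q} u"
    and "\<And>x t. \<lbrakk>x \<in> {p<..<q}; 0 < t\<rbrakk> \<Longrightarrow>
      deriv (deriv (\<lambda>s. u x s)) t - a\<^sup>2 * deriv (deriv (\<lambda>y. u y t)) x = 0"
  shows "wave_strip a p q u (partial_x {p..q} u) (partial_t u)
    (partial_x {p..q} (partial_t u)) (partial_x {p..q} (partial_x {p..q} u))"
proof
  have C1: "C1_strip {p..q} u" "C1_strip {p..q} (partial_x {p..q} u)" "C1_strip {p..q} (partial_t u)"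
    using assms(2) by (auto simp: C2_strip_def)
  show "((\<lambda>s. partial_t u x s) has_real_derivative
      a\<^sup>2 * partial_x {p..q} (partial_x {p..q} u) x t) (at t within {0..})"
    if "x \<in> {p..q}" "0 \<le> t" for x t
    using C1_strip_derivatives(2)[OF C1(3) that] wave_equation_up_to_boundary[OF assms that] by simp
  show "p < q" by fact
qed (use assms(2) in \<open>auto simp: C2_strip_def intro: C1_strip_derivatives\<close>,
     use assms(2) in \<open>auto simp: C2_strip_def C1_strip_def\<close>)

lemma classical_solution_wave_strips:
  assumes "0 < l" "l < L" and sol: "classical_solution a \<sigma> l L \<phi> \<psi> u"
  shows "wave_strip a 0 l u (partial_x {0..l} u) (partial_t u)
      (partial_x {0..l} (partial_t u)) (partial_x {0..l} (partial_x {0..l} u))"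
    and "wave_strip a l L u (partial_x {l..L} u) (partial_t u)
      (partial_x {l..L} (partial_t u)) (partial_x {l..L} (partial_x {l..L} u))"
  using assms by (auto intro!: wave_strip_of_C2 simp: classical_solution_def)

lemma wave_strip_interior_deriv:
  assumes "wave_strip a p q u (partial_x {p..q} u) ut utx uxx" "x \<in> {p<..<q}" "0 \<le> t"
  shows "deriv (\<lambda>y. u y t) x = partial_x {p..q} u x t"
proof (rule partial_x_eq_deriv(2)[OF assms(2)])
  show "(\<lambda>y. u y t) differentiable (at x within {p..q})"
    using wave_strip.u_x[OF assms(1), of x t] assms(2,3)
    by (auto simp: has_real_derivative_iff_has_vector_derivative differentiableI_vector)
qed

text \<open>
  By continuity of the one-sided slope on each closed strip, the limits of \<open>u\<^sub>x\<close> at \<open>l\<close> are its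
  values there.
\<close>
lemma classical_solution_jump:
  assumes "0 < l" "l < L" and sol: "classical_solution a \<sigma> l L \<phi> \<psi> u" and t: "0 \<le> t"
  shows "- partial_x {0..l} u l t + partial_x {l..L} u l t = \<sigma> * u l t"
proof -
  note strips = classical_solution_wave_strips[OF assms(1-3)]
  obtain p' q' where lim: "(deriv (\<lambda>y. u y t) \<longlongrightarrow> p') (at_left l)"
      "(deriv (\<lambda>y. u y t) \<longlongrightarrow> q') (at_right l)" and eq: "- p' + q' = \<sigma> * u l t"
    using sol t unfolding classical_solution_def by meson
  have "((\<lambda>x. partial_x {0..l} u x t) \<longlongrightarrow> partial_x {0..l} u l t) (at_left l)"
    using wave_strip.continuous_slices(1)[OF strips(1) t] assms(1)
    by (auto simp: continuous_on at_within_Icc_at_left dest!: bspec[of _ _ l])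
  moreover have "\<forall>\<^sub>F x in at_left l. partial_x {0..l} u x t = deriv (\<lambda>y. u y t) x"
    by (rule eventually_at_leftI[OF _ assms(1)]) (simp add: wave_strip_interior_deriv[OF strips(1) _ t])
  ultimately have "(deriv (\<lambda>y. u y t) \<longlongrightarrow> partial_x {0..l} u l t) (at_left l)"
    by (rule Lim_transform_eventually)
  then have "p' = partial_x {0..l} u l t"
    by (rule tendsto_unique[OF trivial_limit_at_left_real lim(1)])
  have "((\<lambda>x. partial_x {l..L} u x t) \<longlongrightarrow> partial_x {l..L} u l t) (at_right l)"
    using wave_strip.continuous_slices(1)[OF strips(2) t] assms(2)
    by (auto simp: continuous_on at_within_Icc_at_right dest!: bspec[of _ _ l])
  moreover have "\<forall>\<^sub>F x in at_right l. partial_x {l..L} u x t = deriv (\<lambda>y. u y t) x"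
    by (rule eventually_at_rightI[OF _ assms(2)]) (simp add: wave_strip_interior_deriv[OF strips(2) _ t])
  ultimately have "(deriv (\<lambda>y. u y t) \<longlongrightarrow> partial_x {l..L} u l t) (at_right l)"
    by (rule Lim_transform_eventually)
  then have "q' = partial_x {l..L} u l t"
    by (rule tendsto_unique[OF trivial_limit_at_right_real lim(2)])
  with eq \<open>p' = _\<close> show ?thesis by simp
qed

lemma classical_solution_initial_slope:
  assumes "0 < l" "l < L" and sol: "classical_solution a \<sigma> l L \<phi> \<psi> u"
    and x: "x \<in> {0<..<l} \<union> {l<..<L}"
  shows "deriv \<phi> x = deriv (\<lambda>y. u y 0) x"
proof (rule deriv_cong_ev)
  show "\<forall>\<^sub>F y in nhds x. \<phi> y = u y 0"
    using eventually_nhds_in_open[of "{0<..<L}" x] x assms(1,2) sol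
    by (auto elim!: eventually_mono simp: classical_solution_def)
qed simp

section \<open>Stability with respect to the initial values\<close>
theorem theorem2p2:
  fixes a \<sigma> l L :: real
  assumes "0 < l" and "l < L" and "a > 0" and "\<sigma> > 0"
  shows "\<forall>\<epsilon>>0. \<forall>T>0. \<exists>\<eta>>0. \<forall>u1 u2 \<phi>1 \<psi>1 \<phi>2 \<psi>2.
    classical_solution a \<sigma> l L \<phi>1 \<psi>1 u1 \<longrightarrow>
    classical_solution a \<sigma> l L \<phi>2 \<psi>2 u2 \<longrightarrow>
    split_L2_norm l L (\<lambda>x. \<psi>1 x - \<psi>2 x) \<le> \<eta> \<longrightarrow>
    split_L2_norm l L (\<lambda>x. \<phi>1 x - \<phi>2 x) \<le> \<eta> \<longrightarrow>
    split_L2_norm l L (\<lambda>x. deriv \<phi>1 x - deriv \<phi>2 x) \<le> \<eta> \<longrightarrow>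
    (\<forall>t\<in>{0..T}.
      split_L2_norm l L (\<lambda>x. u1 x t - u2 x t) \<le> \<epsilon> \<and>
      split_L2_norm l L (\<lambda>x. deriv (\<lambda>y. u1 y t) x - deriv (\<lambda>y. u2 y t) x) \<le> \<epsilon> \<and>
      split_L2_norm l L (\<lambda>x. partial_t u1 x t - partial_t u2 x t) \<le> \<epsilon>)"
proof (intro allI impI)
  fix \<epsilon> T :: real
  assume "0 < \<epsilon>" "0 < T"
  (* The three norms at time t are bounded by 2 * eta * sqrt K times 1, 1 / a and L / a; the factor M
     dominates all three. *)
  define K where "K = 1 + a\<^sup>2 + a\<^sup>2 * \<sigma> * l"
  define M where "M = 1 + 1 / a + L / a"
  define \<eta> where "\<eta> = \<epsilon> / (2 * sqrt K * M)"
  have "K > 0" "M > 0"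
    using assms by (auto simp: K_def M_def intro!: add_pos_nonneg)
  have "\<eta> > 0"
    using \<open>0 < \<epsilon>\<close> \<open>K > 0\<close> \<open>M > 0\<close> by (simp add: \<eta>_def)
  have B: "2 * (\<eta> * sqrt K) * M = \<epsilon>"
    using \<open>K > 0\<close> \<open>M > 0\<close> by (simp add: \<eta>_def)
  have \<epsilon>: "2 * (\<eta> * sqrt K) * c \<le> \<epsilon>" if "c \<le> M" for c
    using that mult_left_mono[OF that, of "2 * (\<eta> * sqrt K)"] \<open>K > 0\<close> \<open>\<eta> > 0\<close> by (simp add: B)
  show "\<exists>\<eta>>0. \<forall>u1 u2 \<phi>1 \<psi>1 \<phi>2 \<psi>2.
    classical_solution a \<sigma> l L \<phi>1 \<psi>1 u1 \<longrightarrow>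
    classical_solution a \<sigma> l L \<phi>2 \<psi>2 u2 \<longrightarrow>
    split_L2_norm l L (\<lambda>x. \<psi>1 x - \<psi>2 x) \<le> \<eta> \<longrightarrow>
    split_L2_norm l L (\<lambda>x. \<phi>1 x - \<phi>2 x) \<le> \<eta> \<longrightarrow>
    split_L2_norm l L (\<lambda>x. deriv \<phi>1 x - deriv \<phi>2 x) \<le> \<eta> \<longrightarrow>
    (\<forall>t\<in>{0..T}.
      split_L2_norm l L (\<lambda>x. u1 x t - u2 x t) \<le> \<epsilon> \<and>
      split_L2_norm l L (\<lambda>x. deriv (\<lambda>y. u1 y t) x - deriv (\<lambda>y. u2 y t) x) \<le> \<epsilon> \<and>
      split_L2_norm l L (\<lambda>x. partial_t u1 x t - partial_t u2 x t) \<le> \<epsilon>)"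
  proof (intro exI[of _ \<eta>] conjI allI impI ballI)
    fix u1 u2 \<phi>1 \<psi>1 \<phi>2 \<psi>2 t
    assume sol1: "classical_solution a \<sigma> l L \<phi>1 \<psi>1 u1"
      and sol2: "classical_solution a \<sigma> l L \<phi>2 \<psi>2 u2"
      and \<psi>: "split_L2_norm l L (\<lambda>x. \<psi>1 x - \<psi>2 x) \<le> \<eta>"
      and \<phi>: "split_L2_norm l L (\<lambda>x. deriv \<phi>1 x - deriv \<phi>2 x) \<le> \<eta>"
      and "t \<in> {0..T}"
    then have t: "0 \<le> t" by simp
    note strips1 = classical_solution_wave_strips[OF assms(1,2) sol1]
    note strips2 = classical_solution_wave_strips[OF assms(1,2) sol2]
    note left = wave_strip_diff[OF strips1(1) strips2(1)]
    note right = wave_strip_diff[OF strips1(2) strips2(2)]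
    define v where "v = (\<lambda>x t. u1 x t - u2 x t)"
    define e where "e = (\<lambda>x t. partial_t u1 x t - partial_t u2 x t)"
    define d where "d = (\<lambda>x t. partial_x {0..l} u1 x t - partial_x {0..l} u2 x t)"
    define d' where "d' = (\<lambda>x t. partial_x {l..L} u1 x t - partial_x {l..L} u2 x t)"
    note defs = v_def[symmetric] e_def[symmetric] d_def[symmetric] d'_def[symmetric]
    note left = left[unfolded defs] and right = right[unfolded defs]
    have norms: "split_L2_norm l L f =
        sqrt (integral {0..l} (\<lambda>x. (g x)\<^sup>2)) + sqrt (integral {l..L} (\<lambda>x. (g' x)\<^sup>2))"
      if "continuous_on {0..l} g" "continuous_on {l..L} g'"
        "\<And>x. x \<in> {0<..<l} \<Longrightarrow> f x = g x" "\<And>x. x \<in> {l<..<L} \<Longrightarrow> f x = g' x" for f g g'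
      using L2_norm_on_eq_integral[of 0 l g f] L2_norm_on_eq_integral[of l L g' f] that
      by (simp add: split_L2_norm_def)
    note slices = wave_strip.continuous_slices[OF left] wave_strip.continuous_slices[OF right]
    note interior_slopes = wave_strip_interior_deriv[OF strips1(1)]
      wave_strip_interior_deriv[OF strips1(2)] wave_strip_interior_deriv[OF strips2(1)]
      wave_strip_interior_deriv[OF strips2(2)]
    have slope_norm: "split_L2_norm l L (\<lambda>x. deriv (\<lambda>y. u1 y s) x - deriv (\<lambda>y. u2 y s) x) =
        sqrt (integral {0..l} (\<lambda>x. (d x s)\<^sup>2)) + sqrt (integral {l..L} (\<lambda>x. (d' x s)\<^sup>2))"
      if "0 \<le> s" for s
      using that by (intro norms slices) (simp_all add: d_def d'_def interior_slopes)
    have velocity_norm: "split_L2_norm l L (\<lambda>x. partial_t u1 x s - partial_t u2 x s) =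
        sqrt (integral {0..l} (\<lambda>x. (e x s)\<^sup>2)) + sqrt (integral {l..L} (\<lambda>x. (e x s)\<^sup>2))"
      if "0 \<le> s" for s
      using that by (intro norms slices) (simp_all add: e_def)
    have "continuous_on {0..l} (\<lambda>x. v x t)" "continuous_on {l..L} (\<lambda>x. v x t)"
      by (rule DERIV_continuous_on, erule wave_strip.u_x[OF left _ t],
          rule DERIV_continuous_on, erule wave_strip.u_x[OF right _ t])
    then have v_norm: "split_L2_norm l L (\<lambda>x. u1 x t - u2 x t) =
        sqrt (integral {0..l} (\<lambda>x. (v x t)\<^sup>2)) + sqrt (integral {l..L} (\<lambda>x. (v x t)\<^sup>2))"
      by (intro norms) (auto simp: v_def)
    have "split_L2_norm l L (\<lambda>x. \<psi>1 x - \<psi>2 x) =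
        sqrt (integral {0..l} (\<lambda>x. (e x 0)\<^sup>2)) + sqrt (integral {l..L} (\<lambda>x. (e x 0)\<^sup>2))"
      using sol1 sol2 assms(1,2)
      by (intro norms slices) (simp_all add: e_def classical_solution_def)
    then have velocity: "sqrt (integral {0..l} (\<lambda>x. (e x 0)\<^sup>2))
        + sqrt (integral {l..L} (\<lambda>x. (e x 0)\<^sup>2)) \<le> \<eta>"
      using \<psi> by simp
    have "split_L2_norm l L (\<lambda>x. deriv \<phi>1 x - deriv \<phi>2 x) =
        sqrt (integral {0..l} (\<lambda>x. (d x 0)\<^sup>2)) + sqrt (integral {l..L} (\<lambda>x. (d' x 0)\<^sup>2))"
      by (intro norms slices)
         (simp_all add: d_def d'_def interior_slopes
            classical_solution_initial_slope[OF assms(1,2) sol1]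
            classical_solution_initial_slope[OF assms(1,2) sol2])
    then have slope: "sqrt (integral {0..l} (\<lambda>x. (d x 0)\<^sup>2))
        + sqrt (integral {l..L} (\<lambda>x. (d' x 0)\<^sup>2)) \<le> \<eta>"
      using \<phi> by simp
    have boundary: "v 0 s = 0" "v L s = 0" if "0 \<le> s" for s
      using that sol1 sol2 by (auto simp: v_def classical_solution_def)
    have jump: "- d l s + d' l s = \<sigma> * v l s" if "0 \<le> s" for s
      using classical_solution_jump[OF assms(1,2) sol1 that]
        classical_solution_jump[OF assms(1,2) sol2 that]
      by (simp add: d_def d'_def v_def right_diff_distrib)
    note bounds = transmission_estimate[OF assms(3,4) left right boundary jump t velocity slope,
        folded K_def]
    have M: "1 \<le> M" "1 / a \<le> M" "L / a \<le> M"
      using assms(1-3) by (simp_all add: M_def)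
    show "split_L2_norm l L (\<lambda>x. u1 x t - u2 x t) \<le> \<epsilon>"
      using bounds(3) \<epsilon>[OF M(3)] v_norm by simp
    show "split_L2_norm l L (\<lambda>x. deriv (\<lambda>y. u1 y t) x - deriv (\<lambda>y. u2 y t) x) \<le> \<epsilon>"
      using bounds(2) \<epsilon>[OF M(2)] slope_norm[OF t] by simp
    show "split_L2_norm l L (\<lambda>x. partial_t u1 x t - partial_t u2 x t) \<le> \<epsilon>"
      using bounds(1) \<epsilon>[OF M(1)] velocity_norm[OF t] by simp
  qed fact
qed

end
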